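(* Let $(H;\langle\cdot,\cdot\rangle)$ be an inner product space over the real or complex number field $\mathbb{K}$, let $x_i\in H$ for $i\in\{1,\dots,n\}$, and let $r>0$ be such that $\|x_i-x_j\|\le r$ for $1\le i<j\le n$. Then $$\Big(\sum_{i=1}^n\|x_i\|\Big)^2\le\Big\|\sum_{i=1}^n x_i\Big\|^2+\frac{n(n-1)}{2}r^2.$$ Equality holds in this inequality if and only if $$\|x_i\|\,\|x_j\|-\operatorname{Re}\langle x_i,x_j\rangle=\tfrac12 r^2$$ for each $i,j$ with $1\le i<j\le n$.
   Context: $n$ is a positive integer and $\|\cdot\|$ is the norm induced by the inner product. *)

theory Defs
  imports "HOL-Analysis.Inner_Product"
begin

text \<open>
  The scalar field is the field of real or of complex numbers.  To treat both at once, a scalar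
  type is equipped with a field homomorphism into the complex numbers (necessarily injective)
  whose range is either the real line or everything.  Real parts and conjugates of scalars are
  taken along this identification.
\<close>

class real_or_complex = field +
  fixes to_complex :: "'a \<Rightarrow> complex"
  assumes to_complex_add: "to_complex (a + b) = to_complex a + to_complex b"
    and to_complex_mult: "to_complex (a * b) = to_complex a * to_complex b"
    and to_complex_one: "to_complex 1 = 1"
    and range_to_complex: "range to_complex = \<real> \<or> range to_complex = UNIV"

instantiation real :: real_or_complex
begin
definition to_complex_real :: "real \<Rightarrow> complex" where "to_complex_real = complex_of_real"
instance
  by standard (auto simp: to_complex_real_def Reals_def)
end

instantiation complex :: real_or_complex
begin
definition to_complex_complex :: "complex \<Rightarrow> complex" where "to_complex_complex = (\<lambda>z. z)"
instance
  by standard (auto simp: to_complex_complex_def)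
end

text \<open>
  The inner product is linear in the first argument.  By conjugate symmetry \<open>ip x x\<close> is real, so
  it suffices to require that its real part is nonnegative.
\<close>

locale inner_product_space = vector_space scale
  for scale :: "'k::real_or_complex \<Rightarrow> 'a::ab_group_add \<Rightarrow> 'a" +
  fixes ip :: "'a \<Rightarrow> 'a \<Rightarrow> 'k"
  assumes ip_add_left: "ip (x + y) z = ip x z + ip y z"
    and ip_scale_left: "ip (scale c x) y = c * ip x y"
    and ip_conj_sym: "to_complex (ip x y) = cnj (to_complex (ip y x))"
    and ip_nonneg: "0 \<le> Re (to_complex (ip x x))"
    and ip_definite: "ip x x = 0 \<Longrightarrow> x = 0"

definition ip_norm :: "('a \<Rightarrow> 'a \<Rightarrow> 'k::real_or_complex) \<Rightarrow> 'a \<Rightarrow> real" where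
  "ip_norm ip x = sqrt (Re (to_complex (ip x x)))"

text \<open>
  Every type of class \<open>real_inner\<close> is an instance over the reals, with its usual norm.
  The complex numbers with their Hermitian product are an instance over the complex numbers.
\<close>

lemma inner_product_space_real_inner:
  "inner_product_space scaleR (inner :: 'a::real_inner \<Rightarrow> 'a \<Rightarrow> real)"
  by unfold_locales
    (auto simp: to_complex_real_def inner_add_left scaleR_add_right scaleR_add_left
      intro: inner_commute)

lemma ip_norm_real_inner: "ip_norm inner (x :: 'a::real_inner) = norm x"
  by (simp add: ip_norm_def to_complex_real_def norm_eq_sqrt_inner)

lemma inner_product_space_complex:
  "inner_product_space (*) (\<lambda>z w :: complex. z * cnj w)"
  by unfold_locales (auto simp: to_complex_complex_def algebra_simps)

lemma ip_norm_complex: "ip_norm (\<lambda>z w :: complex. z * cnj w) z = norm z"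
  by (simp add: ip_norm_def to_complex_complex_def cmod_def power2_eq_square)

end

theory Submission
  imports Defs
begin

text \<open>
  Call \<open>\<parallel>x\<parallel> \<parallel>y\<parallel> - Re \<langle>x, y\<rangle>\<close> the Schwarz gap of \<open>x\<close> and \<open>y\<close>.
  Two facts about it carry the result.  Firstly, expanding both squares shows that
  \<open>(\<Sum>\<parallel>x\<^sub>i\<parallel>)\<^sup>2 - \<parallel>\<Sum>x\<^sub>i\<parallel>\<^sup>2\<close> is exactly the sum of the gaps over all
  ordered pairs of indices, and the diagonal pairs contribute nothing
  (\<open>sum_norm_power2_minus_norm_sum_power2\<close>).  Secondly,
  \<open>\<parallel>x - y\<parallel>\<^sup>2 = (\<parallel>x\<parallel> - \<parallel>y\<parallel>)\<^sup>2 + 2 (\<parallel>x\<parallel> \<parallel>y\<parallel> - Re \<langle>x, y\<rangle>)\<close>, so the gap of two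
  vectors at distance at most \<open>r\<close> is at most \<open>r\<^sup>2 / 2\<close> (\<open>schwarz_gap_le\<close>).

  There are \<open>n (n - 1)\<close> ordered off-diagonal pairs, which gives the inequality.  Its two sides
  differ by a sum of the nonnegative shortfalls of the off-diagonal gaps from \<open>r\<^sup>2 / 2\<close>; such
  a sum vanishes only if every term does, and this is the equality case.
\<close>

context inner_product_space
begin

text \<open>
  The real part of the inner product is a symmetric biadditive form whose diagonal is the
  squared norm, whether the scalars are real or complex.  Working with it treats both cases
  at once.
\<close>

abbreviation re_ip :: "'a \<Rightarrow> 'a \<Rightarrow> real" where
  "re_ip x y \<equiv> Re (to_complex (ip x y))"

lemma re_ip_commute: "re_ip x y = re_ip y x"
  using ip_conj_sym[of x y] by simp

lemma re_ip_add_left: "re_ip (x + y) z = re_ip x z + re_ip y z"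
  by (simp add: ip_add_left to_complex_add)

lemma re_ip_diff_left: "re_ip (x - y) z = re_ip x z - re_ip y z"
  using re_ip_add_left[of "x - y" y z] by simp

lemma re_ip_diff_right: "re_ip z (x - y) = re_ip z x - re_ip z y"
  using re_ip_diff_left[of x y z] by (simp only: re_ip_commute[of z])

lemma re_ip_sum_left: "re_ip (\<Sum>i\<in>A. f i) z = (\<Sum>i\<in>A. re_ip (f i) z)"
proof (rule sum_comp_morphism[unfolded o_def, symmetric])
  show "re_ip 0 z = 0"
    using re_ip_add_left[of 0 0 z] by simp
qed (rule re_ip_add_left)

lemma re_ip_sum_right: "re_ip z (\<Sum>i\<in>A. f i) = (\<Sum>i\<in>A. re_ip z (f i))"
  using re_ip_sum_left[of f A z] by (simp only: re_ip_commute[of z])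

lemma ip_norm_power2: "(ip_norm ip x)\<^sup>2 = re_ip x x"
  by (simp add: ip_norm_def ip_nonneg)

definition schwarz_gap :: "'a \<Rightarrow> 'a \<Rightarrow> real" where
  "schwarz_gap x y = ip_norm ip x * ip_norm ip y - re_ip x y"

lemma schwarz_gap_commute: "schwarz_gap x y = schwarz_gap y x"
  by (simp add: schwarz_gap_def re_ip_commute[of x y])

lemma schwarz_gap_self: "schwarz_gap x x = 0"
  using ip_norm_power2[of x] by (simp add: schwarz_gap_def power2_eq_square)

lemma ip_norm_diff_power2:
  "(ip_norm ip (x - y))\<^sup>2 = (ip_norm ip x - ip_norm ip y)\<^sup>2 + 2 * schwarz_gap x y"
  using re_ip_commute[of x y]
  by (simp add: schwarz_gap_def power2_diff ip_norm_power2 re_ip_diff_left re_ip_diff_right)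

lemma schwarz_gap_le:
  assumes "ip_norm ip (x - y) \<le> r"
  shows "schwarz_gap x y \<le> r\<^sup>2 / 2"
proof -
  have "0 \<le> ip_norm ip (x - y)"
    by (simp add: ip_norm_def ip_nonneg)
  with assms have "(ip_norm ip (x - y))\<^sup>2 \<le> r\<^sup>2"
    by (rule power_mono)
  moreover have "0 \<le> (ip_norm ip x - ip_norm ip y)\<^sup>2"
    by simp
  ultimately show ?thesis
    unfolding ip_norm_diff_power2 by linarith
qed

lemma sum_norm_power2_minus_norm_sum_power2:
  "(\<Sum>i\<in>A. ip_norm ip (f i))\<^sup>2 - (ip_norm ip (\<Sum>i\<in>A. f i))\<^sup>2
     = (\<Sum>i\<in>A. \<Sum>j\<in>A. schwarz_gap (f i) (f j))"
proof -
  have "(\<Sum>i\<in>A. ip_norm ip (f i))\<^sup>2 = (\<Sum>i\<in>A. \<Sum>j\<in>A. ip_norm ip (f i) * ip_norm ip (f j))"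
    by (simp add: power2_eq_square sum_product)
  moreover have "(ip_norm ip (\<Sum>i\<in>A. f i))\<^sup>2 = (\<Sum>i\<in>A. \<Sum>j\<in>A. re_ip (f i) (f j))"
    by (simp only: ip_norm_power2 re_ip_sum_left) (simp only: re_ip_sum_right)
  ultimately show ?thesis
    by (simp add: schwarz_gap_def sum_subtractf)
qed

text \<open>
  With \<open>c = r\<^sup>2 / 2\<close> the right-hand side is the slack in the inequality.  Because
  diagonal gaps vanish, the gaps can be summed over ordered pairs of distinct indices only,
  of which there are \<open>card A * (card A - 1)\<close>.
\<close>

lemma sum_shortfalls_eq:
  assumes "finite A"
  shows "(\<Sum>i\<in>A. \<Sum>j\<in>A - {i}. c - schwarz_gap (f i) (f j))
    = (ip_norm ip (\<Sum>i\<in>A. f i))\<^sup>2 + real (card A) * (real (card A) - 1) * c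
        - (\<Sum>i\<in>A. ip_norm ip (f i))\<^sup>2"
proof -
  have "(\<Sum>j\<in>A - {i}. c - schwarz_gap (f i) (f j))
      = (real (card A) - 1) * c - (\<Sum>j\<in>A. schwarz_gap (f i) (f j))" if "i \<in> A" for i
  proof -
    have "real (card (A - {i})) = real (card A) - 1"
      using card.remove[OF assms that] by simp
    moreover have "(\<Sum>j\<in>A - {i}. schwarz_gap (f i) (f j)) = (\<Sum>j\<in>A. schwarz_gap (f i) (f j))"
      using assms that by (simp add: sum.remove schwarz_gap_self)
    ultimately show ?thesis
      by (simp add: sum_subtractf)
  qed
  then have "(\<Sum>i\<in>A. \<Sum>j\<in>A - {i}. c - schwarz_gap (f i) (f j))
      = real (card A) * (real (card A) - 1) * c - (\<Sum>i\<in>A. \<Sum>j\<in>A. schwarz_gap (f i) (f j))"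
    by (simp add: sum_subtractf)
  then show ?thesis
    unfolding sum_norm_power2_minus_norm_sum_power2[symmetric] by simp
qed

end

theorem proposition1:
  fixes scale :: "'k::real_or_complex \<Rightarrow> 'a::ab_group_add \<Rightarrow> 'a"
    and ip :: "'a \<Rightarrow> 'a \<Rightarrow> 'k"
    and x :: "nat \<Rightarrow> 'a"
    and n :: nat
    and r :: real
  assumes "inner_product_space scale ip"
    and "n \<ge> 1"
    and "r > 0"
    and "\<And>i j. 1 \<le> i \<Longrightarrow> i < j \<Longrightarrow> j \<le> n \<Longrightarrow> ip_norm ip (x i - x j) \<le> r"
  shows "(\<Sum>i=1..n. ip_norm ip (x i))\<^sup>2
           \<le> (ip_norm ip (\<Sum>i=1..n. x i))\<^sup>2 + real n * (real n - 1) / 2 * r\<^sup>2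
       \<and> ((\<Sum>i=1..n. ip_norm ip (x i))\<^sup>2
             = (ip_norm ip (\<Sum>i=1..n. x i))\<^sup>2 + real n * (real n - 1) / 2 * r\<^sup>2
           \<longleftrightarrow> (\<forall>i j. 1 \<le> i \<and> i < j \<and> j \<le> n \<longrightarrow>
                  ip_norm ip (x i) * ip_norm ip (x j) - Re (to_complex (ip (x i) (x j)))
                    = 1 / 2 * r\<^sup>2))"
proof -
  interpret inner_product_space scale ip by fact
  define slack where
    "slack = (\<Sum>i\<in>{1..n}. \<Sum>j\<in>{1..n} - {i}. r\<^sup>2 / 2 - schwarz_gap (x i) (x j))"
  have slack_eq: "slack = (ip_norm ip (\<Sum>i=1..n. x i))\<^sup>2 + real n * (real n - 1) / 2 * r\<^sup>2
      - (\<Sum>i=1..n. ip_norm ip (x i))\<^sup>2"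
    unfolding slack_def by (subst sum_shortfalls_eq) simp_all
  \<comment> \<open>The distance bound is given for \<open>i < j\<close>; symmetry of the gap extends its consequence to
    all pairs of distinct indices.\<close>
  have shortfall_nonneg: "0 \<le> r\<^sup>2 / 2 - schwarz_gap (x i) (x j)"
    if "i \<in> {1..n}" "j \<in> {1..n} - {i}" for i j
  proof (cases "i < j")
    case True
    then show ?thesis
      using that assms(4) schwarz_gap_le by simp
  next
    case False
    then have "j < i"
      using that by auto
    then show ?thesis
      using that assms(4) schwarz_gap_le schwarz_gap_commute[of "x i" "x j"] by simp
  qed
  then have "0 \<le> slack"
    unfolding slack_def by (intro sum_nonneg)
  moreover have "slack = 0 \<longleftrightarrow> (\<forall>i\<in>{1..n}. \<forall>j\<in>{1..n} - {i}. schwarz_gap (x i) (x j) = r\<^sup>2 / 2)"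
  proof -
    have "slack = 0 \<longleftrightarrow> (\<forall>i\<in>{1..n}. (\<Sum>j\<in>{1..n} - {i}. r\<^sup>2 / 2 - schwarz_gap (x i) (x j)) = 0)"
      unfolding slack_def
      by (intro sum_nonneg_eq_0_iff sum_nonneg shortfall_nonneg) simp_all
    also have "\<dots> \<longleftrightarrow> (\<forall>i\<in>{1..n}. \<forall>j\<in>{1..n} - {i}. r\<^sup>2 / 2 - schwarz_gap (x i) (x j) = 0)"
      by (intro ball_cong refl sum_nonneg_eq_0_iff shortfall_nonneg) simp_all
    finally show ?thesis
      by (simp only: right_minus_eq eq_commute[of "r\<^sup>2 / 2"])
  qed
  moreover have "(\<forall>i\<in>{1..n}. \<forall>j\<in>{1..n} - {i}. schwarz_gap (x i) (x j) = r\<^sup>2 / 2)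
      \<longleftrightarrow> (\<forall>i j. 1 \<le> i \<and> i < j \<and> j \<le> n \<longrightarrow> schwarz_gap (x i) (x j) = 1 / 2 * r\<^sup>2)"
    (is "?distinct \<longleftrightarrow> ?ordered")
  proof
    assume ordered: ?ordered
    show ?distinct
    proof (intro ballI)
      fix i j
      assume "i \<in> {1..n}" "j \<in> {1..n} - {i}"
      then consider "1 \<le> i \<and> i < j \<and> j \<le> n" | "1 \<le> j \<and> j < i \<and> i \<le> n"
        by fastforce
      then show "schwarz_gap (x i) (x j) = r\<^sup>2 / 2"
        by cases (use ordered schwarz_gap_commute[of "x j" "x i"] in force)+
    qed
  qed auto
  ultimately show ?thesis
    unfolding slack_eq schwarz_gap_def by auto
qed

end
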